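(* One has $${}_3F_2\!\left(\tfrac12,\tfrac12,\tfrac18;\,1,\tfrac38;\,1\right)=\frac{1}{2\pi}\left(\Omega_{-8}^2/\Omega_{-4}+(-1+\sqrt2)\cdot\Omega_{-4}\right),$$ or equivalently, $$F(1/8,3/8)=\pi^{-1}\sqrt{1+\sqrt2}\cdot\Omega_{-8}^2+\pi^{-1}\sqrt{-1+\sqrt2}\cdot\Omega_{-4}^2 .$$
   Context: $B(a,b)=\Gamma(a)\Gamma(b)/\Gamma(a+b)$; ${}_3F_2(a_1,a_2,a_3;1,b;1)=\sum_{k\ge0}\frac{(a_1)_k(a_2)_k(a_3)_k}{k!\,(1)_k(b)_k}$, where $(a)_k=a(a+1)\cdots(a+k-1)$. For rational $r,s$, $F(r,s)=\frac{2^{1-4r}\pi^{-1}}{N}\,P(HD(r,s),1)$, where $N=48/\gcd(24r,24)$ and $P(HD(r,s),1)=\pi\,B(r,s-r)\,{}_3F_2\!\left(\tfrac12,\tfrac12,r;1,s;1\right)$. The Chowla–Selberg periods are $\Omega_{-4}=\sqrt\pi\,\frac{\Gamma(1/4)}{\Gamma(3/4)}$ and $\Omega_{-8}=\sqrt\pi\left(\frac{\Gamma(1/8)\Gamma(3/8)}{\Gamma(5/8)\Gamma(7/8)}\right)^{1/2}$.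
   Formalization: With F as defined (including 1/N, here N=16), the printed formula for F(1/8,3/8) is false: its right side equals 16·F(1/8,3/8) ≈ 23.386 while F(1/8,3/8) ≈ 1.4616; the formal statement multiplies the right side by 1/16. *)

theory Defs
  imports "HOL-Analysis.Analysis"
begin

definition hyp3F2 :: "real \<Rightarrow> real \<Rightarrow> real \<Rightarrow> real \<Rightarrow> real \<Rightarrow> real \<Rightarrow> real" where
  "hyp3F2 a1 a2 a3 b1 b2 z =
     (\<Sum>k. pochhammer a1 k * pochhammer a2 k * pochhammer a3 k
            / (fact k * pochhammer b1 k * pochhammer b2 k) * z ^ k)"

definition Omega_m4 :: real where
  "Omega_m4 = sqrt pi * (Gamma (1/4) / Gamma (3/4))"

definition Omega_m8 :: real where
  "Omega_m8 = sqrt pi *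
     sqrt (Gamma (1/8) * Gamma (3/8) / (Gamma (5/8) * Gamma (7/8)))"

text \<open>The period \<open>P(HD(r,s),1)\<close> of the hypergeometric datum
  \<open>HD(r,s) = {{1/2, 1/2, r}, {1, 1, s}}\<close>.\<close>

definition HD_period :: "rat \<Rightarrow> rat \<Rightarrow> real" where
  "HD_period r s =
     pi * Beta (of_rat r) (of_rat (s - r)) * hyp3F2 (1/2) (1/2) (of_rat r) 1 (of_rat s) 1"

text \<open>The nonnegative generator of the subgroup of the rationals generated by \<open>x\<close> and \<open>y\<close>.
  It makes sense of \<open>gcd (24 r) 24\<close> for every rational \<open>r\<close>, and is the usual gcd when
  both arguments are integers.\<close>

definition rat_gcd :: "rat \<Rightarrow> rat \<Rightarrow> rat" where
  "rat_gcd x y =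
     (let (a, b) = quotient_of x; (c, d) = quotient_of y in Fract (gcd (a * d) (c * b)) (b * d))"

lemma rat_gcd_of_int: "rat_gcd (of_int m) (of_int n) = of_int (gcd m n)"
  by (simp add: rat_gcd_def Fract_of_int_eq)

definition HD_level :: "rat \<Rightarrow> rat" where
  "HD_level r = 48 / rat_gcd (24 * r) 24"

lemma HD_level_one_eighth: "HD_level (1/8) = 16"
  using rat_gcd_of_int[of 3 24] by (simp add: HD_level_def gcd.commute[of 3 24])

definition HD_F :: "rat \<Rightarrow> rat \<Rightarrow> real" where
  "HD_F r s =
     (2 powr (1 - 4 * of_rat r) * inverse pi / of_rat (HD_level r)) * HD_period r s"

text \<open>Since \<open>HD_F\<close> contains the factor \<open>1 / HD_level r\<close>, the closed form of
  \<open>HD_F (1/8) (3/8)\<close> carries the factor \<open>1/16\<close>. The formula that is printed without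
  it describes \<open>HD_level (1/8) * HD_F (1/8) (3/8)\<close>.\<close>

end

theory Submission
  imports Defs
begin

text \<open>The series is contiguous to Dixon's well-poised sum: with \<open>a = b = 1/2\<close> and
  \<open>c = 1/8\<close> the lower parameters are \<open>1 + a - b\<close> and \<open>a - c\<close>. Writing the extra factor
  \<open>a - c + k\<close> as \<open>(a/2 - c) + (a + 2 k)/2\<close> splits it into two very-well-poised series
  \<open>5F4(a, 1 + a/2, b, c, d; a/2, 1 + a - b, 1 + a - c, 1 + a - d; 1)\<close>, with \<open>d = a/2\<close> and
  \<open>d = (1 + a)/2\<close>. Dougall's sum of the \<open>5F4\<close> comes from a telescoping recurrence in
  \<open>a \<mapsto> a + 1\<close> and the limit \<open>a \<rightarrow> \<infinity>\<close>, in which only the term \<open>k = 0\<close> survives.\<close>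

section \<open>Asymptotics of quotients of Pochhammer symbols\<close>

text \<open>Gauss's limit for 1/Gamma, applied to each of the eight parameters. With four symbols on
  either side the factorials in \<open>rGamma_series\<close> cancel and only powers of
  \<open>n\<close> remain. It serves twice: for the decay of the coefficients and for the Gamma
  quotient in Dougall's sum.\<close>

lemma pochhammer_ratio_LIMSEQ:
  fixes x1 x2 x3 x4 y1 y2 y3 y4 :: real
  assumes "y1 > 0" "y2 > 0" "y3 > 0" "y4 > 0"
  shows "(\<lambda>n. pochhammer x1 (Suc n) * pochhammer x2 (Suc n) * pochhammer x3 (Suc n) * pochhammer x4 (Suc n) /
             (pochhammer y1 (Suc n) * pochhammer y2 (Suc n) * pochhammer y3 (Suc n) * pochhammer y4 (Suc n))
             * real n powr (y1 + y2 + y3 + y4 - x1 - x2 - x3 - x4))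
         \<longlonglongrightarrow> rGamma x1 * rGamma x2 * rGamma x3 * rGamma x4 /
             (rGamma y1 * rGamma y2 * rGamma y3 * rGamma y4)"
proof (rule Lim_transform_eventually)
  have nz: "rGamma y \<noteq> 0" if "y > 0" for y :: real
    using that by (auto simp: rGamma_eq_zero_iff elim!: nonpos_Ints_cases)
  show "(\<lambda>n. rGamma_series x1 n * rGamma_series x2 n * rGamma_series x3 n * rGamma_series x4 n /
             (rGamma_series y1 n * rGamma_series y2 n * rGamma_series y3 n * rGamma_series y4 n))
         \<longlonglongrightarrow> rGamma x1 * rGamma x2 * rGamma x3 * rGamma x4 /
             (rGamma y1 * rGamma y2 * rGamma y3 * rGamma y4)"
    by (intro tendsto_intros) (simp add: nz assms)
  show "\<forall>\<^sub>F n in sequentially.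
     rGamma_series x1 n * rGamma_series x2 n * rGamma_series x3 n * rGamma_series x4 n /
             (rGamma_series y1 n * rGamma_series y2 n * rGamma_series y3 n * rGamma_series y4 n) =
     pochhammer x1 (Suc n) * pochhammer x2 (Suc n) * pochhammer x3 (Suc n) * pochhammer x4 (Suc n) /
             (pochhammer y1 (Suc n) * pochhammer y2 (Suc n) * pochhammer y3 (Suc n) * pochhammer y4 (Suc n))
             * real n powr (y1 + y2 + y3 + y4 - x1 - x2 - x3 - x4)"
    using eventually_gt_at_top[of "0::nat"]
  proof eventually_elim
    case (elim n)
    have rs: "rGamma_series x n = pochhammer x (Suc n) / (fact n * real n powr x)" for x
      using elim by (simp add: rGamma_series_def powr_def)
    have e: "real n powr (y1 + y2 + y3 + y4 - x1 - x2 - x3 - x4) =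
        real n powr y1 * real n powr y2 * real n powr y3 * real n powr y4 /
        (real n powr x1 * real n powr x2 * real n powr x3 * real n powr x4)"
      by (simp add: powr_add powr_diff)
    show ?case unfolding rs e by (simp add: mult_ac)
  qed
qed

section \<open>Well-poised coefficients and their shift in \<open>a\<close>\<close>

text \<open>Well-poised means that each upper parameter and the lower one beneath it add up to
  \<open>1 + a\<close>; \<open>fact k\<close> is \<open>pochhammer 1 k\<close>, the partner of
  \<open>pochhammer a k\<close>.\<close>

definition wp_coeff :: "real \<Rightarrow> real \<Rightarrow> real \<Rightarrow> real \<Rightarrow> nat \<Rightarrow> real" where
  "wp_coeff a b c d k = pochhammer a k * pochhammer b k * pochhammer c k * pochhammer d k /
     (fact k * pochhammer (1 + a - b) k * pochhammer (1 + a - c) k * pochhammer (1 + a - d) k)"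

lemma wp_coeff_Suc:
  "wp_coeff a b c d (Suc k) = wp_coeff a b c d k * ((a + k) * (b + k) * (c + k) * (d + k)) /
     ((1 + k) * (1 + a - b + k) * (1 + a - c + k) * (1 + a - d + k))"
  by (simp add: wp_coeff_def pochhammer_Suc mult_ac)

lemma pochhammer_plus1:
  fixes a :: "'a :: field_char_0"
  assumes "a \<noteq> 0"
  shows "pochhammer (a + 1) k = pochhammer a k * ((a + of_nat k) / a)"
  using assms pochhammer_rec[of a k] pochhammer_rec'[of a k] by (simp add: field_simps)

lemma wp_coeff_plus1:
  assumes "a \<noteq> 0" "1 + a - b \<noteq> 0" "1 + a - c \<noteq> 0" "1 + a - d \<noteq> 0"
  shows "wp_coeff (a + 1) b c d k = wp_coeff a b c d k * ((a + k) / a) *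
     ((1 + a - b) / (1 + a - b + k)) * ((1 + a - c) / (1 + a - c + k)) * ((1 + a - d) / (1 + a - d + k))"
proof -
  have sh: "1 + (a + 1) - x = 1 + a - x + 1" for x :: real by simp
  show ?thesis
    unfolding wp_coeff_def sh pochhammer_plus1[OF assms(1)] pochhammer_plus1[OF assms(2)]
      pochhammer_plus1[OF assms(3)] pochhammer_plus1[OF assms(4)]
    by (simp add: mult_ac)
qed

lemma wp_coeff_nonneg:
  assumes "a > 0" "b > 0" "c > 0" "d > 0" "1 + a - b > 0" "1 + a - c > 0" "1 + a - d > 0"
  shows "wp_coeff a b c d k \<ge> 0"
  using assms unfolding wp_coeff_def by (intro divide_nonneg_nonneg mult_nonneg_nonneg pochhammer_nonneg) auto

text \<open>The exponent is the sum of the lower parameters, with 1 for the factorial, minus the sum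
  of the upper ones. The limit stays anonymous because only the order of decay is of
  interest.\<close>

lemma wp_coeff_LIMSEQ:
  fixes a b c d :: real
  assumes "1 + a - b > 0" "1 + a - c > 0" "1 + a - d > 0"
  shows "\<exists>L. (\<lambda>n. wp_coeff a b c d (Suc n) * real n powr (2 + 2 * (1 + a - b - c - d))) \<longlonglongrightarrow> L"
  using pochhammer_ratio_LIMSEQ[of 1 "1 + a - b" "1 + a - c" "1 + a - d" a b c d] assms
  unfolding wp_coeff_def pochhammer_fact
  by (intro exI) (simp add: algebra_simps)

section \<open>The very-well-poised series and its telescoping recurrence\<close>

text \<open>The factor \<open>(a + 2 * real k) / a\<close> equals
  \<open>pochhammer (1 + a/2) k / pochhammer (a/2) k\<close>, so these are the terms of the 5F4 in
  Dougall's sum.\<close>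

definition vwp_term :: "real \<Rightarrow> real \<Rightarrow> real \<Rightarrow> real \<Rightarrow> nat \<Rightarrow> real" where
  "vwp_term a b c d k = (a + 2 * real k) / a * wp_coeff a b c d k"

text \<open>Gosper's algorithm applied to the recurrence \<open>a \<mapsto> a + 1\<close>, after division by the common
  gamma factors; the factor \<open>k + s + a\<close> is the polynomial part of its solution.\<close>
lemma dougall_certificate:
  fixes a b c d k :: real
  defines "s \<equiv> 1 + a - b - c - d"
  shows "(1 + a - b - c) * (1 + a - b - d) * (1 + a - c - d) * (a + 1 + 2 * k) * (a + k)
       - s * (a + 2 * k) * ((1 + a - b + k) * (1 + a - c + k) * (1 + a - d + k))
     = (k + 1 + s + a) * ((a + k) * (b + k) * (c + k) * (d + k))
       - (k + s + a) * k * ((1 + a - b + k) * (1 + a - c + k) * (1 + a - d + k))"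
  unfolding s_def by algebra

lemma vwp_term_plus1:
  assumes "a > 0" "1 + a - b > 0" "1 + a - c > 0" "1 + a - d > 0"
  shows "vwp_term (a + 1) b c d k = vwp_term a b c d k *
     ((a + 1 + 2 * real k) * (a + k) * ((1 + a - b) * (1 + a - c) * (1 + a - d))) /
     ((a + 2 * real k) * (a + 1) * ((1 + a - b + k) * (1 + a - c + k) * (1 + a - d + k)))"
proof -
  have "a + 2 * real k > 0" using assms by (intro add_pos_nonneg) auto
  then show ?thesis
    using assms by (simp add: vwp_term_def wp_coeff_plus1 mult_ac)
qed

text \<open>The quotient of the two coefficients is the one that Dougall's closed form predicts for
  the sums at \<open>a\<close> and \<open>a + 1\<close>, so the combination should sum to 0;
  \<open>G\<close> is the antidifference that shows it.\<close>

lemma vwp_term_telescope: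
  fixes a b c d :: real
  defines "s \<equiv> 1 + a - b - c - d"
  defines "G \<equiv> \<lambda>k::nat. (real k + s + a) * real k * wp_coeff a b c d k / a"
  assumes "a > 0" "1 + a - b > 0" "1 + a - c > 0" "1 + a - d > 0"
  shows "(1 + a) * (1 + a - b - c) * (1 + a - b - d) * (1 + a - c - d) /
           ((1 + a - b) * (1 + a - c) * (1 + a - d)) * vwp_term (a + 1) b c d k
         - s * vwp_term a b c d k = G (Suc k) - G k"
proof -
  define P where "P = (1 + a - b - c) * (1 + a - b - d) * (1 + a - c - d)"
  define Q where "Q = (1 + a - b) * (1 + a - c) * (1 + a - d)"
  define B where "B = (1 + a - b + k) * (1 + a - c + k) * (1 + a - d + k)"
  define A where "A = (a + k) * (b + k) * (c + k) * (d + k)"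
  \<comment> \<open>Once the denominators \<open>Q\<close> and \<open>a + 1\<close> have cancelled,
    every term of the recurrence is a polynomial times \<open>w\<close>. This reduces the claim to
    \<open>dougall_certificate\<close>.\<close>
  define w where "w = wp_coeff a b c d k / (a * B)"
  have B: "B > 0"
    unfolding B_def using assms by (intro mult_pos_pos add_pos_nonneg) auto
  have Q: "Q > 0"
    unfolding Q_def using assms by (intro mult_pos_pos) auto
  have a2: "a + 2 * real k > 0" using assms by (intro add_pos_nonneg) auto
  have wp: "wp_coeff a b c d k = w * (a * B)"
    using B assms by (simp add: w_def)
  have t: "vwp_term a b c d k = (a + 2 * real k) * B * w"
    using assms by (simp add: vwp_term_def wp)
  have t': "vwp_term (a + 1) b c d k = w * (a + 1 + 2 * real k) * (a + k) * Q / (a + 1)"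
    using assms(3-) B a2
    by (subst vwp_term_plus1) (simp_all flip: B_def Q_def add: t)
  have den: "(1 + real k) * (1 + a - b + k) * (1 + a - c + k) * (1 + a - d + k) = (1 + real k) * B"
    by (simp add: B_def)
  \<comment> \<open>The denominator \<open>1 + k\<close> cancels against the factor
    \<open>real (Suc k)\<close> in \<open>G (Suc k)\<close>.\<close>
  have "wp_coeff a b c d (Suc k) = w * a * A / (1 + k)"
    unfolding wp_coeff_Suc wp den using B by (simp flip: A_def)
  then have GS: "G (Suc k) = (real k + 1 + s + a) * A * w"
    using assms(3) by (simp add: G_def add_ac)
  have Gk: "G k = (k + s + a) * k * B * w"
    using assms(3) by (simp add: G_def wp)
  have cert: "P * (a + 1 + 2 * real k) * (a + k) - s * (a + 2 * real k) * B = (real k + 1 + s + a) * A - (k + s + a) * k * B"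
    unfolding P_def A_def B_def s_def by (rule dougall_certificate)
  have "(1 + a) * P / Q * vwp_term (a + 1) b c d k - s * vwp_term a b c d k
      = (P * (a + 1 + 2 * real k) * (a + k) - s * (a + 2 * real k) * B) * w"
    using Q assms(3) unfolding t t' by (simp add: divide_simps) (simp add: algebra_simps)
  also have "\<dots> = G (Suc k) - G k"
    unfolding cert GS Gk by (simp add: algebra_simps)
  finally show ?thesis by (simp add: P_def Q_def mult.assoc)
qed

section \<open>Convergence and the summed recurrence\<close>

lemma affine_over_LIMSEQ: "(\<lambda>n. (p * real n + q) / real n) \<longlonglongrightarrow> p"
proof (rule Lim_transform_eventually)
  show "(\<lambda>n. p + q * inverse (real n)) \<longlonglongrightarrow> p"
    by (rule tendsto_eq_intros lim_inverse_n | simp)+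
  show "\<forall>\<^sub>F n in sequentially. p + q * inverse (real n) = (p * real n + q) / real n"
    using eventually_gt_at_top[of "0::nat"] by eventually_elim (simp add: field_simps)
qed

text \<open>The coefficients are of order at most \<open>n powr (-2 - 2 * s)\<close>, and the linear
  factor \<open>a + 2 * k\<close> costs one power of \<open>n\<close>. The resulting exponent
  \<open>-1 - 2 * s\<close> lies below -1 because \<open>s\<close> is positive.\<close>

lemma vwp_term_summable:
  fixes a b c d :: real
  assumes "a > 0" "1 + a - b > 0" "1 + a - c > 0" "1 + a - d > 0" "1 + a - b - c - d > 0"
  shows "summable (vwp_term a b c d)"
proof -
  define s where "s = 1 + a - b - c - d"
  obtain L where L: "(\<lambda>n. wp_coeff a b c d (Suc n) * real n powr (2 + 2 * s)) \<longlonglongrightarrow> L"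
    using wp_coeff_LIMSEQ[of a b c d] assms by (auto simp: s_def)
  \<comment> \<open>\<open>f n\<close> is the term of index \<open>Suc n\<close> rescaled by
    \<open>n powr (1 + 2 * s)\<close>; \<open>2 * real n + (a + 2)\<close> is the linear factor at
    \<open>Suc n\<close>.\<close>
  define f where "f = (\<lambda>n. wp_coeff a b c d (Suc n) * real n powr (2 + 2 * s) *
      ((2 * real n + (a + 2)) / real n) / a)"
  have "f \<longlonglongrightarrow> L * 2 / a"
    unfolding f_def using assms by (intro tendsto_intros L affine_over_LIMSEQ) auto
  then have "Bseq f" by (intro convergent_imp_Bseq convergentI)
  then obtain K where K: "\<forall>n. norm (f n) \<le> K" by (rule BseqE)
  have bound: "norm (vwp_term a b c d (Suc n)) \<le> K * real n powr (-1 - 2 * s)" if "n \<ge> 1" for n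
  proof -
    have pw: "real n powr (2 + 2 * s) * real n powr (-1 - 2 * s) = real n"
      using that by (simp flip: powr_add)
    have "vwp_term a b c d (Suc n) = wp_coeff a b c d (Suc n) * (real n powr (2 + 2 * s) * real n powr (-1 - 2 * s)) *
      ((2 * real n + (a + 2)) / real n) / a"
      unfolding pw using that assms by (simp add: vwp_term_def field_simps)
    also have "\<dots> = f n * real n powr (-1 - 2 * s)"
      by (simp add: f_def mult_ac)
    also have "norm \<dots> = norm (f n) * real n powr (-1 - 2 * s)"
      by (simp add: abs_mult)
    also have "\<dots> \<le> K * real n powr (-1 - 2 * s)"
      by (intro mult_right_mono K[rule_format]) simp
    finally show ?thesis .
  qed
  have "summable (\<lambda>n. K * real n powr (-1 - 2 * s))"
    using assms by (intro summable_mult) (simp add: summable_real_powr_iff s_def)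
  then have "summable (\<lambda>n. vwp_term a b c d (Suc n))"
    using bound by (rule summable_comparison_test'[where N = 1])
  then show ?thesis by (simp only: summable_Suc_iff)
qed

text \<open>This is the boundary term at infinity of the telescoping sum: a quadratic factor against
  coefficients of order at most \<open>k powr (-2 - 2 * s)\<close> leaves
  \<open>k powr (-2 * s)\<close>.\<close>

lemma vwp_certificate_LIMSEQ:
  fixes a b c d :: real
  defines "s \<equiv> 1 + a - b - c - d"
  assumes "a > 0" "1 + a - b > 0" "1 + a - c > 0" "1 + a - d > 0" "s > 0"
  shows "(\<lambda>k. (real k + s + a) * real k * wp_coeff a b c d k / a) \<longlonglongrightarrow> 0"
proof -
  obtain L where L: "(\<lambda>n. wp_coeff a b c d (Suc n) * real n powr (2 + 2 * s)) \<longlonglongrightarrow> L"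
    using wp_coeff_LIMSEQ[of a b c d] assms by (auto simp: s_def)
  have "(\<lambda>n. real n powr (- 2 * s)) \<longlonglongrightarrow> 0"
    using assms by (intro tendsto_neg_powr filterlim_real_sequentially) auto
  then have "(\<lambda>n. (wp_coeff a b c d (Suc n) * real n powr (2 + 2 * s)) * ((1 * real n + (1 + s + a)) / real n)
       * ((1 * real n + 1) / real n) * real n powr (- 2 * s) / a) \<longlonglongrightarrow> L * 1 * 1 * 0 / a"
    using assms by (intro tendsto_intros L affine_over_LIMSEQ) auto
  moreover have "\<forall>\<^sub>F n in sequentially.
      (wp_coeff a b c d (Suc n) * real n powr (2 + 2 * s)) * ((1 * real n + (1 + s + a)) / real n)
       * ((1 * real n + 1) / real n) * real n powr (- 2 * s) / a
     = (real (Suc n) + s + a) * real (Suc n) * wp_coeff a b c d (Suc n) / a"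
    using eventually_gt_at_top[of "0::nat"]
  proof eventually_elim
    case (elim n)
    have pw: "real n powr (2 + 2 * s) = (real n * real n) * real n powr (2 * s)"
      using elim by (simp add: powr_add power2_eq_square)
    show ?case
      using elim assms(2) unfolding pw by (simp add: powr_minus field_simps)
  qed
  ultimately have "(\<lambda>n. (real (Suc n) + s + a) * real (Suc n) * wp_coeff a b c d (Suc n) / a) \<longlonglongrightarrow> 0"
    by (auto elim!: Lim_transform_eventually)
  then show ?thesis
    by (rule LIMSEQ_imp_Suc)
qed

text \<open>In the sum of \<open>vwp_term_telescope\<close> both boundary terms vanish: at infinity
  by \<open>vwp_certificate_LIMSEQ\<close>, at 0 through the factor \<open>real k\<close> of
  \<open>G\<close>.\<close>

lemma vwp_suminf_step:
  fixes a b c d :: real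
  assumes "a > 0" "b > 0" "c > 0" "d > 0" "1 + a - b - c - d > 0"
  shows "(\<Sum>k. vwp_term a b c d k) =
    (1 + a) * (1 + a - b - c) * (1 + a - b - d) * (1 + a - c - d) /
      ((1 + a - b) * (1 + a - c) * (1 + a - d) * (1 + a - b - c - d)) * (\<Sum>k. vwp_term (a + 1) b c d k)"
proof -
  define s where "s = 1 + a - b - c - d"
  define R where "R = (1 + a) * (1 + a - b - c) * (1 + a - b - d) * (1 + a - c - d) /
           ((1 + a - b) * (1 + a - c) * (1 + a - d))"
  define G where "G = (\<lambda>k::nat. (real k + s + a) * real k * wp_coeff a b c d k / a)"
  have pos: "1 + a - b > 0" "1 + a - c > 0" "1 + a - d > 0" "s > 0"
    using assms by (auto simp: s_def)
  have "(\<lambda>k. R * vwp_term (a + 1) b c d k - s * vwp_term a b c d k) sums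
      (R * (\<Sum>k. vwp_term (a + 1) b c d k) - s * (\<Sum>k. vwp_term a b c d k))"
    using assms by (intro sums_diff sums_mult summable_sums vwp_term_summable) auto
  also have "(\<lambda>k. R * vwp_term (a + 1) b c d k - s * vwp_term a b c d k) = (\<lambda>k. G (Suc k) - G k)"
    unfolding R_def s_def G_def using assms pos by (intro ext vwp_term_telescope) auto
  finally have "(\<lambda>k. G (Suc k) - G k) sums
      (R * (\<Sum>k. vwp_term (a + 1) b c d k) - s * (\<Sum>k. vwp_term a b c d k))" .
  moreover have "(\<lambda>k. G (Suc k) - G k) sums (0 - G 0)"
    using assms pos unfolding G_def s_def by (intro telescope_sums vwp_certificate_LIMSEQ) auto
  ultimately have "R * (\<Sum>k. vwp_term (a + 1) b c d k) - s * (\<Sum>k. vwp_term a b c d k) = 0 - G 0"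
    by (rule sums_unique2)
  then have "R * (\<Sum>k. vwp_term (a + 1) b c d k) - s * (\<Sum>k. vwp_term a b c d k) = 0"
    by (simp add: G_def)
  then have "(\<Sum>k. vwp_term a b c d k) = R / s * (\<Sum>k. vwp_term (a + 1) b c d k)"
    using pos by (simp add: field_simps)
  then show ?thesis by (simp add: R_def s_def mult.assoc)
qed

section \<open>The limit of the series as \<open>a\<close> tends to infinity\<close>

lemma vwp_term_nonneg:
  assumes "a > 0" "b > 0" "c > 0" "d > 0" "1 + a - b > 0" "1 + a - c > 0" "1 + a - d > 0"
  shows "vwp_term a b c d k \<ge> 0"
  unfolding vwp_term_def using assms wp_coeff_nonneg[OF assms]
  by (intro mult_nonneg_nonneg divide_nonneg_nonneg) auto

text \<open>The factor \<open>1 + a - b\<close>, which grows along \<open>a \<mapsto> a + 1\<close>, forces the tails of the series to 0.\<close>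
lemma vwp_term_decay:
  assumes "a \<ge> 1" "b > 0" "c > 0" "d > 0" "1 + a - b > 0" "1 + a - c > 0" "1 + a - d > 0" "k \<ge> 1"
  shows "(1 + (a + 1) - b) * vwp_term (a + 1) b c d k \<le> (1 + a - b) * vwp_term a b c d k"
proof -
  define p q r where "p = 1 + a - b" "q = 1 + a - c" "r = 1 + a - d"
  note pqr = this
  define x where "x = real k"
  have x: "x \<ge> 1" using assms by (simp add: x_def)
  have pos: "p > 0" "q > 0" "r > 0" "q \<le> 2 * a" "r \<le> 2 * a" "a \<ge> 1"
    using assms by (auto simp: pqr)
  have a2: "a + 2 * x > 0" using pos x by linarith
  have "(a + x) * (q * r) \<le> a * ((q + x) * (r + x))"
  proof -
    \<comment> \<open>The bounds \<open>q, r \<le> 2 * a\<close> hold because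
      \<open>1 + a \<le> 2 * a\<close>. The mean of the two resulting bounds on \<open>q * r\<close>
      is \<open>a * (q + r)\<close>.\<close>
    have "q * r \<le> 2 * a * r" "r * q \<le> 2 * a * q" using pos by (auto intro!: mult_right_mono)
    then have "q * r \<le> a * (q + r)" by (simp add: algebra_simps)
    also have "\<dots> \<le> a * (q + r) + a * x" using pos x by simp
    finally have "x * (q * r) \<le> x * (a * (q + r) + a * x)" using x by (intro mult_left_mono) auto
    then show ?thesis by (simp add: algebra_simps)
  qed
  moreover have "(a + 1 + 2 * x) * a \<le> (a + 2 * x) * (a + 1)"
    using x by (simp add: algebra_simps)
  ultimately have "(a + 1 + 2 * x) * a * ((a + x) * (q * r)) \<le> (a + 2 * x) * (a + 1) * (a * ((q + x) * (r + x)))"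
    by (intro mult_mono[of "(a + 1 + 2 * x) * a"]) (use pos x in auto)
  then have "(a + 1 + 2 * x) * (a + x) * (q * r) * a \<le> (a + 2 * x) * (a + 1) * ((q + x) * (r + x)) * a"
    by (simp add: mult_ac)
  then have "(a + 1 + 2 * x) * (a + x) * (q * r) \<le> (a + 2 * x) * (a + 1) * ((q + x) * (r + x))"
    using pos by simp
  \<comment> \<open>Here \<open>k \<ge> 1\<close> enters, as \<open>p + 1 \<le> p + x\<close>. The
    term at 0 is constantly 1 and does not decay.\<close>
  then have "(p + 1) * ((a + 1 + 2 * x) * (a + x) * (q * r)) \<le> (p + x) * ((a + 2 * x) * (a + 1) * ((q + x) * (r + x)))"
    by (intro mult_mono[of "p + 1"]) (use pos x in auto)
  then have "p * ((p + 1) * ((a + 1 + 2 * x) * (a + x) * (q * r))) \<le> p * ((p + x) * ((a + 2 * x) * (a + 1) * ((q + x) * (r + x))))"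
    using pos by (intro mult_left_mono) auto
  then have "(p + 1) * ((a + 1 + 2 * x) * (a + x) * (p * q * r)) / ((a + 2 * x) * (a + 1) * ((p + x) * (q + x) * (r + x))) \<le> p"
    using pos x a2 by (simp add: divide_le_eq mult_ac)
  then have "vwp_term a b c d k * ((p + 1) * ((a + 1 + 2 * x) * (a + x) * (p * q * r)) / ((a + 2 * x) * (a + 1) * ((p + x) * (q + x) * (r + x))))
     \<le> vwp_term a b c d k * p"
    using assms by (intro mult_left_mono vwp_term_nonneg) auto
  moreover have "vwp_term (a + 1) b c d k = vwp_term a b c d k *
      ((a + 1 + 2 * x) * (a + x) * (p * q * r)) / ((a + 2 * x) * (a + 1) * ((p + x) * (q + x) * (r + x)))"
    unfolding pqr x_def using assms by (intro vwp_term_plus1) auto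
  ultimately have "(p + 1) * vwp_term (a + 1) b c d k \<le> p * vwp_term a b c d k"
    by (simp add: mult_ac)
  moreover have "1 + (a + 1) - b = p + 1" by (simp add: pqr)
  ultimately show ?thesis by (simp only: pqr)
qed

text \<open>The term at 0 is 1. The remaining sum \<open>D n\<close> is nonnegative, and its product
  with \<open>1 + (a + n) - b\<close> does not increase with \<open>n\<close>, so \<open>D n\<close>
  is O(1/n).\<close>

lemma vwp_suminf_LIMSEQ:
  fixes a b c d :: real
  assumes "a \<ge> 1" "b > 0" "c > 0" "d > 0" "1 + a - b - c - d > 0"
  shows "(\<lambda>n. \<Sum>k. vwp_term (a + real n) b c d k) \<longlonglongrightarrow> 1"
proof -
  have sm: "summable (vwp_term (a + real n) b c d)" for n
    using assms by (intro vwp_term_summable) auto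
  have nn: "vwp_term (a + real n) b c d k \<ge> 0" for n k
    using assms by (intro vwp_term_nonneg) auto
  define D where "D = (\<lambda>n::nat. \<Sum>k. vwp_term (a + real n) b c d (Suc k))"
  have sm': "summable (\<lambda>k. vwp_term (a + real n) b c d (Suc k))" for n
    using sm[of n] by (simp only: summable_Suc_iff)
  have t0: "vwp_term (a + real n) b c d 0 = 1" for n
    using assms by (simp add: vwp_term_def wp_coeff_def)
  have one: "(\<Sum>k. vwp_term (a + real n) b c d k) = 1 + D n" for n
    using suminf_split_head[OF sm[of n]] by (simp add: D_def t0)
  have dec: "(1 + (a + real n) - b) * D n \<le> (1 + a - b) * D 0" for n
  proof (induction n)
    case (Suc n)
    have "(1 + (a + real n + 1) - b) * D (Suc n) =
        (\<Sum>k. (1 + (a + real n + 1) - b) * vwp_term (a + real n + 1) b c d (Suc k))"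
      unfolding D_def using suminf_mult[OF sm'[of "Suc n"], of "1 + (a + real n + 1) - b"]
      by (simp add: add_ac)
    also have "\<dots> \<le> (\<Sum>k. (1 + (a + real n) - b) * vwp_term (a + real n) b c d (Suc k))"
    proof (intro suminf_le summable_mult vwp_term_decay)
      show "summable (\<lambda>k. vwp_term (a + real n + 1) b c d (Suc k))"
        using sm'[of "Suc n"] by (simp add: add_ac)
    qed (use assms sm' in auto)
    also have "\<dots> = (1 + (a + real n) - b) * D n"
      unfolding D_def by (intro suminf_mult sm')
    also note Suc
    finally show ?case by (simp add: add_ac)
  qed simp
  have "D \<longlonglongrightarrow> 0"
  proof (rule tendsto_sandwich)
    show "\<forall>\<^sub>F n in sequentially. 0 \<le> D n"
      unfolding D_def by (intro always_eventually allI suminf_nonneg sm' nn)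
    have "D n \<le> (1 + a - b) * D 0 / (1 + (a + real n) - b)" for n
      using dec[of n] assms by (subst pos_le_divide_eq) (auto simp: mult_ac)
    then show "\<forall>\<^sub>F n in sequentially. D n \<le> (1 + a - b) * D 0 / (1 + (a + real n) - b)"
      by simp
    have "filterlim (\<lambda>n. (1 + a - b) + real n) at_top sequentially"
      by (intro filterlim_tendsto_add_at_top[OF tendsto_const] filterlim_real_sequentially)
    then show "(\<lambda>n. (1 + a - b) * D 0 / (1 + (a + real n) - b)) \<longlonglongrightarrow> 0"
      by (intro tendsto_divide_0[OF tendsto_const] filterlim_at_top_imp_at_infinity) (simp add: algebra_simps)
  qed simp
  from tendsto_add[OF tendsto_const[of 1] this] show ?thesis by (simp add: one)
qed

section \<open>Dougall's sum in closed form\<close>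

theorem dougall_5F4:
  fixes a b c d :: real
  assumes "a > 0" "b > 0" "c > 0" "d > 0" "1 + a - b - c - d > 0"
  shows "vwp_term a b c d sums
    (Gamma (1 + a - b) * Gamma (1 + a - c) * Gamma (1 + a - d) * Gamma (1 + a - b - c - d) /
     (Gamma (1 + a) * Gamma (1 + a - b - c) * Gamma (1 + a - b - d) * Gamma (1 + a - c - d)))"
proof -
  define F where "F = (\<lambda>a. \<Sum>k. vwp_term a b c d k)"
  \<comment> \<open>The product of the first \<open>n\<close> factors that
    \<open>vwp_suminf_step\<close> produces.\<close>
  define R where "R = (\<lambda>a n. pochhammer (1 + a) n * pochhammer (1 + a - b - c) n *
      pochhammer (1 + a - b - d) n * pochhammer (1 + a - c - d) n /
      (pochhammer (1 + a - b) n * pochhammer (1 + a - c) n * pochhammer (1 + a - d) n *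
       pochhammer (1 + a - b - c - d) n))"
  have FR: "F a = R a n * F (a + real n)" if "a > 0" "1 + a - b - c - d > 0" for a n
    using that
  proof (induction n arbitrary: a)
    case (Suc n)
    \<comment> \<open>Moving the shift outward lets \<open>pochhammer_rec\<close> split off the
      first factor, so that the recurrence factor at \<open>a\<close> times
      \<open>R (a + 1) n\<close> becomes \<open>R a (Suc n)\<close>.\<close>
    have sh: "1 + (a + 1) = 1 + a + 1" "x + 1 - y = x - y + 1" for x y :: real
      by simp_all
    have "F a = (1 + a) * (1 + a - b - c) * (1 + a - b - d) * (1 + a - c - d) /
      ((1 + a - b) * (1 + a - c) * (1 + a - d) * (1 + a - b - c - d)) * F (a + 1)"
      unfolding F_def using Suc.prems assms by (intro vwp_suminf_step) auto
    also have "F (a + 1) = R (a + 1) n * F (a + 1 + real n)"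
      using Suc.prems by (intro Suc.IH) auto
    also have "(1 + a) * (1 + a - b - c) * (1 + a - b - d) * (1 + a - c - d) /
      ((1 + a - b) * (1 + a - c) * (1 + a - d) * (1 + a - b - c - d)) * (R (a + 1) n * F (a + 1 + real n))
       = R a (Suc n) * F (a + real (Suc n))"
      unfolding R_def sh pochhammer_rec of_nat_Suc add.assoc[of a]
      by (simp only: times_divide_times_eq times_divide_eq_left times_divide_eq_right divide_divide_eq_left mult_ac)
    finally show ?case .
  qed (simp add: R_def)
  \<comment> \<open>The exponent is 0 because upper and lower parameters have the same sum.\<close>
  have "(\<lambda>n. R a (Suc n) * real n powr 0) \<longlonglongrightarrow>
     rGamma (1 + a) * rGamma (1 + a - b - c) * rGamma (1 + a - b - d) * rGamma (1 + a - c - d) /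
     (rGamma (1 + a - b) * rGamma (1 + a - c) * rGamma (1 + a - d) * rGamma (1 + a - b - c - d))"
    (is "_ \<longlonglongrightarrow> ?N")
    using pochhammer_ratio_LIMSEQ[of "1 + a - b" "1 + a - c" "1 + a - d" "1 + a - b - c - d"
        "1 + a" "1 + a - b - c" "1 + a - b - d" "1 + a - c - d"] assms
    unfolding R_def by simp
  \<comment> \<open>Starting at \<open>a + 1\<close> meets the premise \<open>a \<ge> 1\<close> of
    \<open>vwp_suminf_LIMSEQ\<close>; \<open>a + 1 + n\<close> is \<open>a + Suc n\<close>, matching
    \<open>R a (Suc n)\<close>.\<close>
  moreover have "(\<lambda>n. F (a + 1 + real n)) \<longlonglongrightarrow> 1"
    unfolding F_def using assms by (intro vwp_suminf_LIMSEQ) auto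
  ultimately have "(\<lambda>n. R a (Suc n) * real n powr 0 * F (a + 1 + real n)) \<longlonglongrightarrow> ?N * 1"
    by (intro tendsto_mult)
  \<comment> \<open>Only for \<open>n > 0\<close>, since \<open>0 powr 0 = 0\<close>.\<close>
  moreover have "\<forall>\<^sub>F n in sequentially. R a (Suc n) * real n powr 0 * F (a + 1 + real n) = F a"
    using eventually_gt_at_top[of "0::nat"]
  proof eventually_elim
    case (elim n)
    then show ?case using FR[of a "Suc n"] assms by (simp add: add_ac)
  qed
  ultimately have "(\<lambda>n. F a) \<longlonglongrightarrow> ?N"
    using Lim_transform_eventually by fastforce
  then have "F a = ?N" by (simp add: LIMSEQ_const_iff)
  moreover have "vwp_term a b c d sums F a"
    unfolding F_def using assms by (intro summable_sums vwp_term_summable) auto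
  ultimately show ?thesis by (simp add: Gamma_def field_simps)
qed

section \<open>Real Gamma identities and trigonometric values at \<open>pi / 8\<close>\<close>

lemma Gamma_reflection_real: "Gamma x * Gamma (1 - x) = pi / sin (pi * x)" for x :: real
proof -
  have "complex_of_real (Gamma x * Gamma (1 - x)) = Gamma (of_real x) * Gamma (1 - of_real x)"
    using Gamma_complex_of_real[of x] Gamma_complex_of_real[of "1 - x"] by simp
  also have "\<dots> = of_real (pi / sin (pi * x))"
    using sin_of_real[of "pi * x", where 'a = complex] by (simp add: Gamma_reflection_complex)
  finally show ?thesis by (simp only: of_real_eq_iff)
qed

lemma Gamma_duplication_real:
  fixes x :: real
  assumes "x > 0"
  shows "Gamma x * Gamma (x + 1/2) = 2 powr (1 - 2 * x) * sqrt pi * Gamma (2 * x)"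
proof -
  have "complex_of_real x \<notin> \<int>\<^sub>\<le>\<^sub>0" "complex_of_real x + 1/2 \<notin> \<int>\<^sub>\<le>\<^sub>0"
    using assms by (auto elim!: nonpos_Ints_cases simp: complex_eq_iff)
  note L = Gamma_legendre_duplication[OF this]
  have "complex_of_real (Gamma x * Gamma (x + 1/2)) = Gamma (of_real x) * Gamma (of_real x + 1/2)"
    using Gamma_complex_of_real[of "x + 1/2"] by (simp add: Gamma_complex_of_real)
  also have "\<dots> = of_real (exp ((1 - 2 * x) * ln 2) * sqrt pi * Gamma (2 * x))"
    unfolding L using Gamma_complex_of_real[of "2 * x"] exp_of_real[of "(1 - 2 * x) * ln 2", where 'a = complex]
    by simp
  finally show ?thesis by (simp only: of_real_eq_iff powr_def) simp
qed

lemma sin_pi_eighth: "sin (pi / 8) = sqrt (2 - sqrt 2) / 2"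
proof -
  have "cos (pi / 4) = 1 - 2 * sin (pi / 8) ^ 2"
    using cos_double_sin[of "pi / 8"] by simp
  then have "(2 * sin (pi / 8)) ^ 2 = 2 - sqrt 2"
    by (simp add: cos_45 power2_eq_square)
  moreover have "sin (pi / 8) > 0" by (intro sin_gt_zero) auto
  ultimately have "sqrt (2 - sqrt 2) = 2 * sin (pi / 8)"
    by (intro real_sqrt_unique) auto
  then show ?thesis by simp
qed

lemma tan_pi_eighth: "tan (pi / 8) = sqrt 2 - 1"
proof -
  have "tan (pi / 8) = sqrt 2 / (sqrt 2 + 2)"
    using tan_half[of "pi / 8"] by (simp add: sin_45 cos_45 field_simps)
  also have "\<dots> = sqrt 2 - 1"
  proof -
    have "sqrt 2 + 2 \<noteq> (0 :: real)" by (rule less_imp_neq[symmetric]) (simp add: add_pos_pos)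
    moreover have "sqrt 2 = (sqrt 2 - 1) * (sqrt 2 + 2)" by (simp add: algebra_simps)
    ultimately show ?thesis by (metis nonzero_eq_divide_eq)
  qed
  finally show ?thesis .
qed

section \<open>The contiguous Dixon sum\<close>

text \<open>For \<open>d = a/2\<close> the pair of \<open>d\<close> cancels the factor
  \<open>(a + 2 * k) / a\<close>, which leaves Dixon's series. For \<open>d = (1 + a) / 2\<close>
  one has \<open>1 + a - d = d\<close>, so the pair cancels itself and the factor stays. The bound
  on \<open>b + c\<close> is the convergence condition of the second series.\<close>

theorem contiguous_dixon_3F2:
  fixes a b c :: real
  assumes "0 < b" "0 < c" "c < a" "b + c < (1 + a) / 2"
  shows "hyp3F2 a b c (1 + a - b) (a - c) 1 =
     (a - 2 * c) / (2 * (a - c)) *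
       (Gamma (1 + a - b) * Gamma (1 + a - c) * Gamma (1 + a / 2) * Gamma (1 + a / 2 - b - c) /
        (Gamma (1 + a) * Gamma (1 + a - b - c) * Gamma (1 + a / 2 - b) * Gamma (1 + a / 2 - c))) +
     a / (2 * (a - c)) *
       (Gamma (1 + a - b) * Gamma (1 + a - c) * Gamma ((1 + a) / 2) * Gamma ((1 + a) / 2 - b - c) /
        (Gamma (1 + a) * Gamma (1 + a - b - c) * Gamma ((1 + a) / 2 - b) * Gamma ((1 + a) / 2 - c)))"
    (is "_ = ?u * ?D + ?v * ?V")
proof -
  have d1: "1 + a - a / 2 = 1 + a / 2" "1 + a - b - a / 2 = 1 + a / 2 - b"
    "1 + a - c - a / 2 = 1 + a / 2 - c" "1 + a - b - c - a / 2 = 1 + a / 2 - b - c"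
    by simp_all
  have d2: "1 + a - (1 + a) / 2 = (1 + a) / 2" "1 + a - b - (1 + a) / 2 = (1 + a) / 2 - b"
    "1 + a - c - (1 + a) / 2 = (1 + a) / 2 - c" "1 + a - b - c - (1 + a) / 2 = (1 + a) / 2 - b - c"
    by (simp_all add: field_simps)
  have "vwp_term a b c (a / 2) sums ?D"
    using dougall_5F4[of a b c "a / 2"] assms unfolding d1 by simp
  moreover have "vwp_term a b c ((1 + a) / 2) sums ?V"
    using dougall_5F4[of a b c "(1 + a) / 2"] assms unfolding d2 by simp
  ultimately have "(\<lambda>k. ?u * vwp_term a b c (a / 2) k + ?v * vwp_term a b c ((1 + a) / 2) k)
      sums (?u * ?D + ?v * ?V)"
    by (intro sums_add sums_mult)
  moreover have "?u * vwp_term a b c (a / 2) k + ?v * vwp_term a b c ((1 + a) / 2) k =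
      pochhammer a k * pochhammer b k * pochhammer c k /
        (fact k * pochhammer (1 + a - b) k * pochhammer (a - c) k) * 1 ^ k" for k
  proof -
    define w where "w = pochhammer a k * pochhammer b k * pochhammer c k /
        (fact k * pochhammer (1 + a - b) k)"
    have h: "1 + a / 2 = a / 2 + 1" "1 + a - c = a - c + 1" by simp_all
    have pos: "pochhammer (a / 2) k > 0" "pochhammer ((1 + a) / 2) k > 0" "pochhammer (a - c) k > 0"
      "a / 2 + k > 0" "a - c + k > 0" "a + 2 * real k > 0"
      using assms by (auto intro!: pochhammer_pos add_pos_nonneg)
    have half: "(a / 2 + k) / (a / 2) = (a + 2 * real k) / a"
      using assms by (simp add: field_simps)
    have pa: "pochhammer (1 + a / 2) k = pochhammer (a / 2) k * ((a + 2 * real k) / a)"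
      unfolding h half[symmetric] using assms by (intro pochhammer_plus1) auto
    have pc: "pochhammer (1 + a - c) k = pochhammer (a - c) k * ((a - c + k) / (a - c))"
      unfolding h using assms by (intro pochhammer_plus1) auto
    have "vwp_term a b c (a / 2) k = w / pochhammer (1 + a - c) k *
        ((a + 2 * real k) / a * (pochhammer (a / 2) k / pochhammer (1 + a / 2) k))"
      unfolding vwp_term_def wp_coeff_def d1 w_def by (simp add: mult_ac)
    also have "(a + 2 * real k) / a * (pochhammer (a / 2) k / pochhammer (1 + a / 2) k) = 1"
      unfolding pa using pos assms by simp
    finally have t1: "vwp_term a b c (a / 2) k = w / pochhammer (1 + a - c) k" by simp
    have t2: "vwp_term a b c ((1 + a) / 2) k = w / pochhammer (1 + a - c) k * ((a + 2 * real k) / a)"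
      unfolding vwp_term_def wp_coeff_def d2 w_def using pos by (simp add: mult_ac)
    have "?u * vwp_term a b c (a / 2) k + ?v * vwp_term a b c ((1 + a) / 2) k
       = w / pochhammer (1 + a - c) k * (?u + ?v * ((a + 2 * real k) / a))"
      unfolding t1 t2 by (simp only: distrib_left mult_ac)
    \<comment> \<open>This fixes the weights: \<open>a - c + k\<close> is
      \<open>(a/2 - c) + (a + 2 * k) / 2\<close>, divided by \<open>a - c\<close>.\<close>
    also have "?u + ?v * ((a + 2 * real k) / a) = (a - c + k) / (a - c)"
      using assms by (simp add: divide_simps) (simp add: algebra_simps)
    also have "w / pochhammer (1 + a - c) k * ((a - c + k) / (a - c)) = w / pochhammer (a - c) k"
      unfolding pc using pos assms by simp
    finally show ?thesis by (simp add: w_def)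
  qed
  ultimately show ?thesis
    unfolding hyp3F2_def by (simp add: sums_iff)
qed

section \<open>Evaluation at eighths in terms of the Chowla-Selberg periods\<close>

text \<open>The Dixon part yields the multiple of \<open>Omega_m4\<close>, where reflection turns
  the Gamma values at eighths into \<open>tan (pi / 8)\<close>. The other part yields
  \<open>Omega_m8^2 / Omega_m4\<close>.\<close>

lemma hyp3F2_eighth:
  "hyp3F2 (1/2) (1/2) (1/8) 1 (3/8) 1
     = 1 / (2 * pi) * (Omega_m8^2 / Omega_m4 + (-1 + sqrt 2) * Omega_m4)"
proof -
  have step: "Gamma (x + 1) = x * Gamma x" if "x > 0" for x :: real
    using that by (intro Gamma_plus1) (auto elim!: nonpos_Ints_cases)
  have G: "Gamma (11/8) = 3/8 * Gamma (3/8 :: real)" "Gamma (5/4) = 1/4 * Gamma (1/4 :: real)"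
    "Gamma (9/8) = 1/8 * Gamma (1/8 :: real)" "Gamma (3/2) = 1/2 * sqrt pi"
    using step[of "3/8"] step[of "1/4"] step[of "1/8"] step[of "1/2"]
    by (simp_all add: Gamma_one_half_real)
  have pos: "Gamma (1/8 :: real) > 0" "Gamma (3/8 :: real) > 0" "Gamma (5/8 :: real) > 0"
    "Gamma (7/8 :: real) > 0" "Gamma (1/4 :: real) > 0" "Gamma (3/4 :: real) > 0"
    by simp_all
  have "Gamma (1/8) * Gamma (7/8 :: real) = pi / sin (pi / 8)"
    using Gamma_reflection_real[of "1/8"] by simp
  moreover have "Gamma (3/8) * Gamma (5/8 :: real) = pi / cos (pi / 8)"
    using Gamma_reflection_real[of "3/8"] sin_cos_eq[of "pi * 3 / 8"]
    by (simp add: field_simps)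
  ultimately have "Gamma (3/8) * Gamma (5/8) / (Gamma (1/8) * Gamma (7/8 :: real)) = tan (pi / 8)"
    by (simp add: tan_def)
  then have refl: "Gamma (3/8) * Gamma (5/8 :: real) = (-1 + sqrt 2) * (Gamma (1/8) * Gamma (7/8))"
    using pos by (simp add: tan_pi_eighth divide_eq_eq)
  have O8: "Omega_m8 ^ 2 = pi * (Gamma (1/8) * Gamma (3/8) / (Gamma (5/8) * Gamma (7/8)))"
    using pos by (simp add: Omega_m8_def power_mult_distrib)
  \<comment> \<open>Here \<open>gi\<close> stands for \<open>Gamma (i/8)\<close>, \<open>r\<close>
    for \<open>sqrt pi\<close>, \<open>p\<close> for \<open>pi\<close> and \<open>t\<close> for
    \<open>-1 + sqrt 2\<close>; what remains is a field identity.\<close>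
  have regroup: "1/2 * (g2 * (t * (g1 * g7)) / (r * g7 * g6 * g1)) + 1/2 * (g3 * g6 * g1 / (r * g7 * g2 * g5))
      = 1 / (2 * p) * (p * (g1 * g3 / (g5 * g7)) / (r * (g2 / g6)) + t * (r * (g2 / g6)))"
    if "g1 > 0" "g2 > 0" "g5 > 0" "g6 > 0" "g7 > 0" "r > 0" "p = r^2" for g1 g2 g3 g5 g6 g7 p r t :: real
    using that by (simp add: field_simps power2_eq_square)
  have "hyp3F2 (1/2) (1/2) (1/8) 1 (3/8) 1 =
     1/3 * (Gamma (11/8) * Gamma (5/4) * Gamma (5/8) / (Gamma (3/2) * Gamma (7/8) * Gamma (3/4) * Gamma (9/8)))
   + 2/3 * (Gamma (11/8) * Gamma (3/4) * Gamma (1/8) / (Gamma (3/2) * Gamma (7/8) * Gamma (1/4) * Gamma (5/8)))"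
    \<comment> \<open>The variables are instantiated in the order \<open>b\<close>,
      \<open>c\<close>, \<open>a\<close> of their occurrence in the premises.\<close>
    using contiguous_dixon_3F2[of "1/2" "1/8" "1/2"] by simp
  also have "\<dots> = 1/2 * (Gamma (1/4) * (Gamma (3/8) * Gamma (5/8)) / (sqrt pi * Gamma (7/8) * Gamma (3/4) * Gamma (1/8)))
     + 1/2 * (Gamma (3/8) * Gamma (3/4) * Gamma (1/8) / (sqrt pi * Gamma (7/8) * Gamma (1/4) * Gamma (5/8)))"
    unfolding G by (simp add: mult_ac)
  also have "\<dots> = 1 / (2 * pi) * (Omega_m8^2 / Omega_m4 + (-1 + sqrt 2) * Omega_m4)"
    unfolding O8 Omega_m4_def refl by (rule regroup) (use pos in auto)
  finally show ?thesis .
qed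

text \<open>\<open>Gamma (1/8) / Gamma (3/8)\<close> is expanded by \<open>Gamma (7/8)\<close>:
  reflection evaluates the numerator, duplication at \<open>3/8\<close> the denominator. The factor
  \<open>sqrt 2\<close> is \<open>2 powr (1 - 4 * r)\<close> at \<open>r = 1/8\<close>, from
  \<open>HD_F\<close>.\<close>

lemma Beta_eighth: "sqrt 2 * Beta (1/8) (1/4) = 2 * sqrt (1 + sqrt 2) * Omega_m4"
proof -
  have pos: "Gamma (7/8 :: real) > 0" by simp
  have refl: "Gamma (1/8) * Gamma (7/8 :: real) = pi / sin (pi / 8)"
    using Gamma_reflection_real[of "1/8"] by simp
  have dup: "Gamma (3/8) * Gamma (7/8 :: real) = 2 powr (1/4) * sqrt pi * Gamma (3/4)"
    using Gamma_duplication_real[of "3/8"] by simp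
  define y :: real where "y = 2 powr (1/4)"
  have y: "y > 0" by (simp add: y_def)
  have y2: "y ^ 2 = sqrt 2"
    by (simp add: y_def power2_eq_square powr_half_sqrt flip: powr_add)
  have sin_pos: "sin (pi / 8) > 0" by (intro sin_gt_zero) auto
  \<comment> \<open>The square is \<open>sqrt 2 * (2 - sqrt 2) * (1 + sqrt 2) = 2\<close>.\<close>
  have half: "y * (2 * sin (pi / 8)) * sqrt (1 + sqrt 2) = sqrt 2"
  proof (rule real_sqrt_unique[symmetric])
    have "sqrt 2 \<le> 2" by (rule real_le_lsqrt) auto
    then show "(y * (2 * sin (pi / 8)) * sqrt (1 + sqrt 2))\<^sup>2 = 2"
      by (simp add: sin_pi_eighth power_mult_distrib y2) (simp add: algebra_simps)
    show "0 \<le> y * (2 * sin (pi / 8)) * sqrt (1 + sqrt 2)"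
      using y sin_pos by simp
  qed
  have "Gamma (1/8) / Gamma (3/8 :: real) = (Gamma (1/8) * Gamma (7/8)) / (Gamma (3/8) * Gamma (7/8))"
    using pos by (metis mult_divide_mult_cancel_right less_irrefl)
  also have "\<dots> = pi / (sin (pi / 8) * (y * sqrt pi * Gamma (3/4)))"
    unfolding refl dup y_def by simp
  also have "\<dots> = sqrt pi / (sin (pi / 8) * y * Gamma (3/4))"
    by (simp add: real_div_sqrt divide_simps)
  finally have ratio: "Gamma (1/8) / Gamma (3/8 :: real) = sqrt pi / (sin (pi / 8) * y * Gamma (3/4))" .
  have "sqrt 2 * Beta (1/8) (1/4) = sqrt 2 * (Gamma (1/8) / Gamma (3/8)) * Gamma (1/4 :: real)"
    by (simp add: Beta_def)
  also have "\<dots> = (y * (2 * sin (pi / 8)) * sqrt (1 + sqrt 2)) *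
      (sqrt pi / (sin (pi / 8) * y * Gamma (3/4))) * Gamma (1/4)"
    by (simp only: half ratio)
  also have "\<dots> = 2 * sqrt (1 + sqrt 2) * Omega_m4"
    unfolding Omega_m4_def using y sin_pos by simp
  finally show ?thesis .
qed

theorem corollary5p7:
  shows "hyp3F2 (1/2) (1/2) (1/8) 1 (3/8) 1
           = 1 / (2 * pi) * (Omega_m8^2 / Omega_m4 + (-1 + sqrt 2) * Omega_m4)
       \<and> HD_F (1/8) (3/8)
           = 1 / 16 * (inverse pi * sqrt (1 + sqrt 2) * Omega_m8^2
                       + inverse pi * sqrt (-1 + sqrt 2) * Omega_m4^2)"
proof (intro conjI hyp3F2_eighth)
  have r: "(of_rat (1/8) :: real) = 1/8" "(of_rat (3/8) :: real) = 3/8" "(of_rat (3/8 - 1/8) :: real) = 1/4"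
    "(of_rat 16 :: real) = 16"
    by (simp_all add: of_rat_divide)
  have O4: "Omega_m4 > 0"
    by (simp add: Omega_m4_def)
  \<comment> \<open>The numbers \<open>1 + sqrt 2\<close> and \<open>-1 + sqrt 2\<close> are
    mutually inverse, and so are their square roots.\<close>
  have sq: "sqrt (1 + sqrt 2) * (-1 + sqrt 2) = sqrt (-1 + sqrt 2)"
  proof -
    have "1 = (1 + sqrt 2) * (-1 + sqrt 2)" by (simp add: algebra_simps)
    then have "sqrt (1 + sqrt 2) * sqrt (-1 + sqrt 2) = 1" by (metis real_sqrt_mult real_sqrt_one)
    moreover have "-1 + sqrt 2 = sqrt (-1 + sqrt 2) * sqrt (-1 + sqrt 2)" by simp
    ultimately show ?thesis by (metis mult.assoc mult_1)
  qed
  have "HD_F (1/8) (3/8) = 1/16 * (sqrt 2 * Beta (1/8) (1/4)) * hyp3F2 (1/2) (1/2) (1/8) 1 (3/8) 1"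
    unfolding HD_F_def HD_period_def HD_level_one_eighth r by (simp add: powr_half_sqrt)
  also have "\<dots> = 1/16 * (inverse pi * sqrt (1 + sqrt 2) * Omega_m8^2
      + inverse pi * (sqrt (1 + sqrt 2) * (-1 + sqrt 2)) * Omega_m4^2)"
    unfolding Beta_eighth hyp3F2_eighth using O4 by (simp add: field_simps power2_eq_square)
  finally show "HD_F (1/8) (3/8) = 1 / 16 * (inverse pi * sqrt (1 + sqrt 2) * Omega_m8^2
                       + inverse pi * sqrt (-1 + sqrt 2) * Omega_m4^2)"
    unfolding sq .
qed

end
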